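(* Let $(Q,\mathscr{H})$ be a knowledge space. Then $(Q,\mathscr{H})$ is an ordinal space if and only if $(Q,\tau_{\mathscr{H}})$ is a $T_0$-Alexandroff space.
   Context: A knowledge space $(Q,\mathscr{H})$ is a non-empty set $Q$ with a family $\mathscr{H}\subseteq 2^Q$ containing $\emptyset,Q$ and closed under arbitrary unions. $(Q,\tau_{\mathscr{H}})$ denotes the set $Q$ with open sets $\tau_{\mathscr{H}}=\mathscr{H}$. For $t\in Q$ let $\mathscr{H}_t=\{K\in\mathscr{H}:t\in K\}$. $(Q,\mathscr{H})$ is discriminative if $\mathscr{H}_r=\mathscr{H}_t$ implies $r=t$ for all $r,t\in Q$. It is a quasi ordinal space if $\mathscr{H}$ is closed under (arbitrary) intersections; an ordinal space is a discriminative quasi ordinal space. An Alexandroff space is a topological space in which arbitrary intersections of open sets are open. $T_0$ means that for any distinct $y,z$ there is an open set containing exactly one of them. *)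

theory Defs
  imports "HOL-Analysis.Abstract_Topological_Spaces"
begin

definition knowledge_space :: "'a set \<Rightarrow> 'a set set \<Rightarrow> bool" where
  "knowledge_space Q H \<longleftrightarrow>
     Q \<noteq> {} \<and> H \<subseteq> Pow Q \<and> {} \<in> H \<and> Q \<in> H \<and> (\<forall>F. F \<subseteq> H \<longrightarrow> \<Union>F \<in> H)"

definition states_at :: "'a set set \<Rightarrow> 'a \<Rightarrow> 'a set set" where
  "states_at H t = {K \<in> H. t \<in> K}"

definition discriminative :: "'a set \<Rightarrow> 'a set set \<Rightarrow> bool" where
  "discriminative Q H \<longleftrightarrow> (\<forall>r\<in>Q. \<forall>t\<in>Q. states_at H r = states_at H t \<longrightarrow> r = t)"

(* Intersections are taken over non-empty families only: in HOL the intersection of the empty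
   family is UNIV.  The intersection of the empty family relative to Q is Q, which is in H anyway. *)
definition quasi_ordinal_space :: "'a set \<Rightarrow> 'a set set \<Rightarrow> bool" where
  "quasi_ordinal_space Q H \<longleftrightarrow>
     knowledge_space Q H \<and> (\<forall>F. F \<subseteq> H \<and> F \<noteq> {} \<longrightarrow> \<Inter>F \<in> H)"

definition ordinal_space :: "'a set \<Rightarrow> 'a set set \<Rightarrow> bool" where
  "ordinal_space Q H \<longleftrightarrow> quasi_ordinal_space Q H \<and> discriminative Q H"

definition alexandroff_space :: "'a topology \<Rightarrow> bool" where
  "alexandroff_space X \<longleftrightarrow>
     (\<forall>F. (\<forall>U\<in>F. openin X U) \<and> F \<noteq> {} \<longrightarrow> openin X (\<Inter>F))"

(* The set Q with T as its family of open sets is a T0 Alexandroff space.  A family T need not be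
   a topology, so that it is one is part of the claim: this is the existence of X, which Q and T
   determine uniquely. *)
definition t0_alexandroff_on :: "'a set \<Rightarrow> 'a set set \<Rightarrow> bool" where
  "t0_alexandroff_on Q T \<longleftrightarrow>
     (\<exists>X. topspace X = Q \<and> {U. openin X U} = T \<and> t0_space X \<and> alexandroff_space X)"

end

theory Submission
  imports Defs
begin

text \<open>A knowledge space lacks only closure under binary intersections to be a topology, and
  closure under all non-empty intersections supplies it
  (\<open>quasi_ordinal_space_istopology\<close>). Once \<open>H\<close> is the family of open sets
  of some \<open>X\<close> on \<open>Q\<close>, the two sides match clause by clause:
  \<open>states_at H r = states_at H t\<close> is topological indistinguishability, so
  discriminative means T0 (\<open>discriminative_openin_iff_t0_space\<close>), and closure under
  intersections is the Alexandroff property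
  (\<open>alexandroff_space_iff_Inter_closed\<close>).\<close>

text \<open>Two points have different families of open neighbourhoods exactly when some open set
  contains one of them and not the other; the rest is contraposition.\<close>

lemma discriminative_openin_iff_t0_space:
  "discriminative (topspace X) {U. openin X U} \<longleftrightarrow> t0_space X"
proof -
  have states_at_eq: "states_at {U. openin X U} x = states_at {U. openin X U} y \<longleftrightarrow>
      \<not> (\<exists>U. openin X U \<and> (x \<notin> U \<longleftrightarrow> y \<in> U))" for x y
    unfolding states_at_def set_eq_iff mem_Collect_eq not_ex by (intro iff_allI) argo
  show ?thesis
    unfolding discriminative_def t0_space_def states_at_eq by (intro ball_cong refl) argo
qed

lemma alexandroff_space_iff_Inter_closed:
  "alexandroff_space X \<longleftrightarrow>
     (\<forall>F. F \<subseteq> {U. openin X U} \<and> F \<noteq> {} \<longrightarrow> \<Inter>F \<in> {U. openin X U})"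
  unfolding alexandroff_space_def by (simp add: subset_iff Ball_def)

lemma quasi_ordinal_space_istopology:
  assumes "quasi_ordinal_space Q H"
  shows "istopology (\<lambda>U. U \<in> H)"
  unfolding istopology_def
proof (intro conjI allI impI)
  fix S T assume "S \<in> H" "T \<in> H"
  \<comment> \<open>Keeping the premises makes this a literal instance of the closure condition, at
    the family of two sets.\<close>
  moreover have "{S, T} \<subseteq> H \<and> {S, T} \<noteq> {} \<longrightarrow> \<Inter>{S, T} \<in> H"
    using assms unfolding quasi_ordinal_space_def by (elim conjE allE)
  ultimately show "S \<inter> T \<in> H" by simp
next
  fix K assume "\<forall>S\<in>K. S \<in> H"
  then have "K \<subseteq> H" by auto
  moreover have "K \<subseteq> H \<longrightarrow> \<Union>K \<in> H"
    using assms unfolding quasi_ordinal_space_def knowledge_space_def by (elim conjE allE)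
  ultimately show "\<Union>K \<in> H" by simp
qed

theorem theorem39:
  fixes Q :: "'a set" and H :: "'a set set"
  assumes "knowledge_space Q H"
  shows "ordinal_space Q H \<longleftrightarrow> t0_alexandroff_on Q H"
proof
  assume ord: "ordinal_space Q H"
  define X where "X = topology (\<lambda>U. U \<in> H)"
  \<comment> \<open>\<open>topology\<close> inverts \<open>openin\<close> only on predicates
    satisfying \<open>istopology\<close>, hence the appeal to quasi ordinality.\<close>
  have openin: "openin X U \<longleftrightarrow> U \<in> H" for U
    using ord quasi_ordinal_space_istopology[of Q H]
    by (simp add: X_def ordinal_space_def topology_inverse')
  have "topspace X = Q"
    using assms unfolding topspace_def openin knowledge_space_def by auto
  moreover have "{U. openin X U} = H"
    by (simp add: openin)
  \<comment> \<open>The equations collected in \<open>calculation\<close> turn the open-set side of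
    the lemma into \<open>discriminative Q H\<close>.\<close>
  moreover have "t0_space X"
    using ord unfolding discriminative_openin_iff_t0_space[symmetric] calculation ordinal_space_def
    by (rule conjunct2)
  moreover have "alexandroff_space X"
    using ord unfolding alexandroff_space_iff_Inter_closed calculation
      ordinal_space_def quasi_ordinal_space_def
    by (elim conjE)
  ultimately show "t0_alexandroff_on Q H"
    unfolding t0_alexandroff_on_def by (intro exI conjI)
next
  assume "t0_alexandroff_on Q H"
  then obtain X where X: "topspace X = Q" "{U. openin X U} = H"
    and "t0_space X" "alexandroff_space X"
    unfolding t0_alexandroff_on_def by (elim exE conjE) (rule that)
  \<comment> \<open>Reading \<open>X\<close> backwards replaces \<open>Q\<close> and
    \<open>H\<close> by the carrier and the open sets of \<open>X\<close>, so that both equivalences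
    apply.\<close>
  then show "ordinal_space Q H"
    using assms
    unfolding ordinal_space_def quasi_ordinal_space_def X[symmetric]
      discriminative_openin_iff_t0_space alexandroff_space_iff_Inter_closed
    by (intro conjI)
qed

end
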